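(* Let $G$ be a finite simple graph that contains no claw as an induced subgraph. If $G$ is nonperfectly divisible (i.e. not perfectly divisible), then $G$ contains a trisimplicial vertex.
   Context: All graphs are finite and simple. A clique is a set of pairwise adjacent vertices (the empty set is allowed), and $\omega(G)$ is the maximum size of a clique of $G$; $\chi(G)$ is the chromatic number. For $X\subseteq V(G)$, $G[X]$ is the subgraph of $G$ induced by $X$. A graph $G$ is perfect if $\chi(H)=\omega(H)$ for every induced subgraph $H$ of $G$. A graph $G$ is perfectly divisible if for every induced subgraph $H$ of $G$ (with at least one vertex), $V(H)$ can be partitioned into two sets $A$ and $B$ (possibly empty) such that $H[A]$ is perfect and $\omega(H[B])<\omega(H)$ (with $\omega=0$ for the graph with no vertices). A graph is nonperfectly divisible if it is not perfectly divisible. A claw is the complete bipartite graph $K_{1,3}$. A vertex of a graph is trisimplicial if its (open) neighbourhood is the union of three cliques. *)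

theory Defs
  imports "HOL-Library.Ramsey"
begin

record 'a ugraph =
  vertices :: "'a set"
  edges :: "'a set set"

definition fin_simple_graph :: "'a ugraph \<Rightarrow> bool" where
  "fin_simple_graph G \<longleftrightarrow> finite (vertices G) \<and> edges G \<subseteq> [vertices G]\<^bsup>2\<^esup>"

(* Meant for X a subset of the vertex set of G. *)
definition induced :: "'a ugraph \<Rightarrow> 'a set \<Rightarrow> 'a ugraph" where
  "induced G X = \<lparr>vertices = X, edges = {e \<in> edges G. e \<subseteq> X}\<rparr>"

definition graph_iso :: "'a ugraph \<Rightarrow> 'b ugraph \<Rightarrow> bool" where
  "graph_iso G H \<longleftrightarrow>
     (\<exists>f. bij_betw f (vertices G) (vertices H) \<and> edges H = (\<lambda>e. f ` e) ` edges G)"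

definition contains_induced :: "'a ugraph \<Rightarrow> 'b ugraph \<Rightarrow> bool" where
  "contains_induced G H \<longleftrightarrow> (\<exists>X \<subseteq> vertices G. graph_iso H (induced G X))"

definition complete_bipartite :: "nat \<Rightarrow> nat \<Rightarrow> (nat + nat) ugraph" where
  "complete_bipartite m n =
     \<lparr>vertices = {..<m} <+> {..<n}, edges = {{Inl i, Inr j} | i j. i < m \<and> j < n}\<rparr>"

definition claw :: "(nat + nat) ugraph" where
  "claw = complete_bipartite 1 3"

(* The library predicate clique K E only asks for pairwise adjacency of distinct
   elements of K; it does not ask that K consist of vertices. *)
definition graph_clique :: "'a ugraph \<Rightarrow> 'a set \<Rightarrow> bool" where
  "graph_clique G K \<longleftrightarrow> K \<subseteq> vertices G \<and> clique K (edges G)"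

definition clique_number :: "'a ugraph \<Rightarrow> nat" where
  "clique_number G = Max {card K | K. graph_clique G K}"

definition colouring :: "'a ugraph \<Rightarrow> nat \<Rightarrow> ('a \<Rightarrow> nat) \<Rightarrow> bool" where
  "colouring G k c \<longleftrightarrow>
     (\<forall>v \<in> vertices G. c v < k) \<and>
     (\<forall>u \<in> vertices G. \<forall>v \<in> vertices G. {u, v} \<in> edges G \<longrightarrow> c u \<noteq> c v)"

definition chromatic_number :: "'a ugraph \<Rightarrow> nat" where
  "chromatic_number G = (LEAST k. \<exists>c. colouring G k c)"

definition perfect :: "'a ugraph \<Rightarrow> bool" where
  "perfect G \<longleftrightarrow>
     (\<forall>X \<subseteq> vertices G. chromatic_number (induced G X) = clique_number (induced G X))"

definition perfectly_divisible :: "'a ugraph \<Rightarrow> bool" where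
  "perfectly_divisible G \<longleftrightarrow>
     (\<forall>X \<subseteq> vertices G. X \<noteq> {} \<longrightarrow>
        (let H = induced G X in
         \<exists>A B. A \<union> B = vertices H \<and> A \<inter> B = {} \<and>
               perfect (induced H A) \<and> clique_number (induced H B) < clique_number H))"

definition neighbourhood :: "'a ugraph \<Rightarrow> 'a \<Rightarrow> 'a set" where
  "neighbourhood G v = {u \<in> vertices G. {v, u} \<in> edges G}"

definition trisimplicial :: "'a ugraph \<Rightarrow> 'a \<Rightarrow> bool" where
  "trisimplicial G v \<longleftrightarrow> v \<in> vertices G \<and>
     (\<exists>K1 K2 K3. graph_clique G K1 \<and> graph_clique G K2 \<and> graph_clique G K3 \<and>
                 neighbourhood G v = K1 \<union> K2 \<union> K3)"

end

theory Submission
  imports Defs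
begin

text \<open>Suppose that the claw-free graph \<open>G\<close> has no trisimplicial vertex. If \<open>v\<close> and \<open>z\<close> are nonadjacent
  and have a common neighbour \<open>y\<close>, then the neighbours of \<open>v\<close> that are not neighbours of \<open>z\<close> form two
  cliques (those adjacent to \<open>y\<close> and those not), so the common neighbourhood of \<open>v\<close> and \<open>z\<close> is never a
  clique; in particular every component has diameter at most 2.

  If a component contains a stable set of size 4, every vertex \<open>v\<close> of a maximum stable set \<open>S\<close> is
  trisimplicial: the neighbours of \<open>v\<close> without a further neighbour in \<open>S\<close> form a clique, and the other
  neighbours induce a graph with bipartite complement.

  Otherwise take a minimal vertex set \<open>X\<close> without a division, which lies in one component, and \<open>x \<in> X\<close>.
  If the nonneighbours of \<open>x\<close> in \<open>X\<close> were the union of two cliques, they would together with \<open>x\<close> induce a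
  perfect graph, and the neighbours of \<open>x\<close> in \<open>X\<close> have smaller clique number. So the nonneighbours
  contain an odd antihole. Every neighbour of \<open>x\<close> sees none of it or exactly a certain arc, and a
  longest run of consecutive arcs whose vertices form a clique is the first of three
  cliques covering the neighbourhood of \<open>x\<close>.\<close>

section \<open>Neighbourhoods in claw-free graphs\<close>

locale claw_free_graph =
  fixes V :: "'a set" and adj :: "'a \<Rightarrow> 'a \<Rightarrow> bool"
  assumes finite_V: "finite V"
    and adj_V: "adj x y \<Longrightarrow> x \<in> V \<and> y \<in> V"
    and adj_sym: "adj x y \<Longrightarrow> adj y x"
    and adj_irrefl: "\<not> adj x x"
    and claw_free: "\<lbrakk>adj c x; adj c y; adj c z; x \<noteq> y; x \<noteq> z; y \<noteq> z\<rbrakk>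
      \<Longrightarrow> adj x y \<or> adj x z \<or> adj y z"
begin

definition clq :: "'a set \<Rightarrow> bool" where
  "clq K \<longleftrightarrow> K \<subseteq> V \<and> (\<forall>x\<in>K. \<forall>y\<in>K. x \<noteq> y \<longrightarrow> adj x y)"

definition nbrs :: "'a \<Rightarrow> 'a set" where
  "nbrs v = {u. adj v u}"

definition tri :: "'a \<Rightarrow> bool" where
  "tri v \<longleftrightarrow> v \<in> V \<and> (\<exists>K1 K2 K3. clq K1 \<and> clq K2 \<and> clq K3 \<and> nbrs v = K1 \<union> K2 \<union> K3)"

definition stable :: "'a set \<Rightarrow> bool" where
  "stable S \<longleftrightarrow> S \<subseteq> V \<and> (\<forall>x\<in>S. \<forall>y\<in>S. \<not> adj x y)"

lemma clqI: "\<lbrakk>\<And>x. x \<in> K \<Longrightarrow> x \<in> V; \<And>x y. \<lbrakk>x \<in> K; y \<in> K; x \<noteq> y\<rbrakk> \<Longrightarrow> adj x y\<rbrakk> \<Longrightarrow> clq K"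
  by (auto simp: clq_def)

lemma triI:
  assumes "v \<in> V" "clq K1" "clq K2" "clq K3" "nbrs v \<subseteq> K1 \<union> K2 \<union> K3"
  shows "tri v"
proof -
  have sub: "clq (K \<inter> nbrs v)" if "clq K" for K
    using that by (auto simp: clq_def)
  have "nbrs v = (K1 \<inter> nbrs v) \<union> (K2 \<inter> nbrs v) \<union> (K3 \<inter> nbrs v)"
    using assms(5) by blast
  then show ?thesis
    unfolding tri_def using assms(1) sub[OF assms(2)] sub[OF assms(3)] sub[OF assms(4)] by metis
qed

text \<open>Otherwise \<open>y\<close> is the centre of a claw with leaves \<open>z\<close>,
  \<open>p\<close>, \<open>q\<close>. Together with the next lemma, whose claw has centre
  \<open>v\<close>: a neighbour \<open>y\<close> of \<open>v\<close> that sees \<open>z\<close> is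
  adjacent to exactly one of two nonadjacent neighbours of \<open>v\<close> that miss
  \<open>z\<close>. This splitting is the main tool below.\<close>

lemma split_at_most_one:
  assumes "adj v y" "adj v p" "adj v q" "\<not> adj v z" "z \<noteq> v" "adj y z"
    "\<not> adj p z" "\<not> adj q z" "\<not> adj p q" "p \<noteq> q"
  shows "\<not> (adj y p \<and> adj y q)"
proof
  assume "adj y p \<and> adj y q"
  moreover have "z \<noteq> p" "z \<noteq> q" using assms by auto
  ultimately show False
    using claw_free[of y z p q] assms adj_sym by blast
qed

lemma split_at_least_one:
  assumes "adj v y" "adj v p" "adj v q" "\<not> adj p q" "p \<noteq> q" "y \<noteq> p" "y \<noteq> q"
  shows "adj y p \<or> adj y q"
  using claw_free[of v y p q] assms by blast

text \<open>The neighbours of \<open>v\<close> that miss \<open>z\<close> are sorted by adjacency to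
  \<open>y\<close>. A nonadjacent pair among those that see \<open>y\<close> gives a claw at
  \<open>y\<close> with leaf \<open>z\<close>; one among the others gives a claw at \<open>v\<close>
  with leaf \<open>y\<close>.\<close>

lemma tri_if_common_nbrs_clique:
  assumes "v \<in> V" "\<not> adj v z" "z \<noteq> v" "adj v y" "adj y z" "clq (nbrs v \<inter> nbrs z)"
  shows "tri v"
proof (rule triI)
  show "clq {p. adj v p \<and> \<not> adj z p \<and> adj y p}"
  proof (rule clqI)
    fix p q assume pq: "p \<in> {p. adj v p \<and> \<not> adj z p \<and> adj y p}"
      "q \<in> {p. adj v p \<and> \<not> adj z p \<and> adj y p}" "p \<noteq> q"
    then show "adj p q"
      using split_at_most_one[of v y p q z] assms adj_sym by blast
  qed (use adj_V in blast)
  show "clq {p. adj v p \<and> \<not> adj z p \<and> \<not> adj y p}"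
  proof (rule clqI)
    fix p q assume pq: "p \<in> {p. adj v p \<and> \<not> adj z p \<and> \<not> adj y p}"
      "q \<in> {p. adj v p \<and> \<not> adj z p \<and> \<not> adj y p}" "p \<noteq> q"
    then show "adj p q"
      using split_at_least_one[of v y p q] assms adj_sym by blast
  qed (use adj_V in blast)
qed (use assms in \<open>auto simp: nbrs_def\<close>)

text \<open>Distance at most 2. In the absence of trisimplicial vertices this relation is
  transitive, so its classes are the components and longer paths need not be considered.\<close>

definition near :: "'a \<Rightarrow> 'a \<Rightarrow> bool" where
  "near u v \<longleftrightarrow> u \<in> V \<and> v \<in> V \<and> (u = v \<or> adj u v \<or> (\<exists>y. adj u y \<and> adj y v))"

lemma near_sym: "near u v \<Longrightarrow> near v u"
  unfolding near_def using adj_sym by blast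

text \<open>A vertex at distance 3 from \<open>v\<close> would make the common neighbourhood of \<open>v\<close> and the
  preceding vertex of a shortest path a clique.\<close>

lemma near_adj:
  assumes no_tri: "\<And>v. \<not> tri v" and "near v z" "adj z u"
  shows "near v u"
proof (rule ccontr)
  assume far: "\<not> near v u"
  have V: "v \<in> V" "u \<in> V" using assms adj_V near_def by auto
  have "z \<noteq> v" "\<not> adj v z" using far assms V by (auto simp: near_def)
  with \<open>near v z\<close> obtain y where y: "adj v y" "adj y z" by (auto simp: near_def)
  have "clq (nbrs v \<inter> nbrs z)"
  proof (rule clqI)
    fix p q assume pq: "p \<in> nbrs v \<inter> nbrs z" "q \<in> nbrs v \<inter> nbrs z" "p \<noteq> q"
    have "\<not> adj p u" "\<not> adj q u" using far V pq by (auto simp: near_def nbrs_def)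
    moreover have "u \<noteq> p" "u \<noteq> q" using far V pq by (auto simp: near_def nbrs_def)
    ultimately show "adj p q"
      using claw_free[of z p q u] pq \<open>adj z u\<close> by (auto simp: nbrs_def)
  qed (use adj_V in \<open>auto simp: nbrs_def\<close>)
  then show False
    using tri_if_common_nbrs_clique[OF \<open>v \<in> V\<close> \<open>\<not> adj v z\<close> \<open>z \<noteq> v\<close> y] no_tri by blast
qed

lemma near_trans:
  assumes no_tri: "\<And>v. \<not> tri v" and "near u v" "near v w"
  shows "near u w"
proof -
  from \<open>near v w\<close> consider "v = w" | "adj v w" | y where "adj v y" "adj y w"
    by (auto simp: near_def)
  then show ?thesis
  proof cases
    case 1
    then show ?thesis using \<open>near u v\<close> by simp
  next
    case 2
    then show ?thesis by (rule near_adj[OF no_tri \<open>near u v\<close>])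
  next
    case 3
    from near_adj[OF no_tri near_adj[OF no_tri \<open>near u v\<close> 3(1)] 3(2)] show ?thesis .
  qed
qed

text \<open>The set \<open>S\<close> is maximum among the stable sets inside one component, which
  pairwise \<open>near\<close> expresses. Three cliques \<open>P\<close>, \<open>A\<close>,
  \<open>B\<close> are built that cover the neighbourhood of \<open>v\<close>.\<close>

lemma no_four_stable_if_no_tri:
  assumes no_tri: "\<And>v. \<not> tri v"
    and S: "stable S" and near_S: "\<And>a b. \<lbrakk>a \<in> S; b \<in> S\<rbrakk> \<Longrightarrow> near a b"
    and max: "\<And>T. \<lbrakk>stable T; \<And>a b. \<lbrakk>a \<in> T; b \<in> T\<rbrakk> \<Longrightarrow> near a b\<rbrakk> \<Longrightarrow> card T \<le> card S"
    and in_S: "{v, z1, z2, z3} \<subseteq> S" and dist: "distinct [v, z1, z2, z3]"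
  shows False
proof -
  define Q where "Q z = nbrs v \<inter> nbrs z" for z
  define P where "P = {y. adj v y \<and> (\<forall>z \<in> S - {v}. \<not> adj z y)}"
  have vS: "v \<in> S" "z1 \<in> S" "z2 \<in> S" "z3 \<in> S" using in_S by auto
  have finS: "finite S" using S finite_V by (auto simp: stable_def dest: finite_subset)
  have nonadj: "\<not> adj a b" if "a \<in> S" "b \<in> S" for a b
    using S that by (auto simp: stable_def)
  have vV: "v \<in> V" using S vS by (auto simp: stable_def)
  \<comment> \<open>If \<open>p\<close> and \<open>q\<close> were nonadjacent, exchanging
    \<open>v\<close> for both of them would enlarge \<open>S\<close>.\<close>
  have P_clq: "clq P"
  proof (rule clqI)
    fix p q assume pq: "p \<in> P" "q \<in> P" "p \<noteq> q"
    show "adj p q"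
    proof (rule ccontr)
      assume npq: "\<not> adj p q"
      let ?T = "insert p (insert q (S - {v}))"
      have notS: "p \<notin> S" "q \<notin> S" using pq nonadj vS by (auto simp: P_def)
      have "stable ?T"
        unfolding stable_def using S pq npq adj_irrefl adj_V
        by (auto simp: stable_def P_def dest: adj_sym)
      moreover have "near a b" if ab: "a \<in> ?T" "b \<in> ?T" for a b
      proof -
        have "near v a" if "a \<in> ?T" for a
          using that near_S vS pq adj_V by (auto simp: P_def near_def)
        from near_trans[OF no_tri near_sym[OF this[OF ab(1)]] this[OF ab(2)]] show ?thesis .
      qed
      ultimately have "card ?T \<le> card S" by (rule max)
      moreover have "card ?T = Suc (Suc (card S - 1))"
        using notS pq finS vS by simp
      moreover have "card S > 0" using vS finS card_gt_0_iff by blast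
      ultimately show False by simp
    qed
  qed (use adj_V P_def in auto)
  have Q_nonempty: "\<exists>y. adj v y \<and> adj y z" if "z \<in> S" "z \<noteq> v" for z
    using near_S[OF vS(1) that(1)] nonadj[OF vS(1) that(1)] that by (auto simp: near_def)
  \<comment> \<open>Otherwise \<open>r\<close> is the centre of a claw with leaves \<open>v\<close>,
    \<open>z\<close>, \<open>z'\<close>. So each neighbour of \<open>v\<close> outside
    \<open>P\<close> sees exactly one further vertex of \<open>S\<close>.\<close>
  have Q_unique: "\<not> (adj r z \<and> adj r z')" if "adj v r" "z \<in> S - {v}" "z' \<in> S - {v}" "z \<noteq> z'" for r z z'
    using claw_free[of r v z z'] that nonadj vS adj_sym by blast
  have Q_edge: "\<exists>p q. adj v p \<and> adj v q \<and> adj p z \<and> adj q z \<and> p \<noteq> q \<and> \<not> adj p q"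
    if "z \<in> S" "z \<noteq> v" for z
  proof (rule ccontr)
    assume "\<not> ?thesis"
    then have "clq (nbrs v \<inter> nbrs z)"
      unfolding nbrs_def by (intro clqI) (use adj_V adj_sym in blast)+
    moreover obtain y where "adj v y" "adj y z" using Q_nonempty \<open>z \<in> S\<close> \<open>z \<noteq> v\<close> by blast
    ultimately show False
      using tri_if_common_nbrs_clique[OF vV nonadj[OF vS(1) \<open>z \<in> S\<close>] \<open>z \<noteq> v\<close>] no_tri by blast
  qed
  have split: "adj r p \<longleftrightarrow> \<not> adj r q"
    if "adj v r" "adj v p" "adj v q" "z \<in> S - {v}" "adj r z" "\<not> adj p z" "\<not> adj q z"
      "\<not> adj p q" "p \<noteq> q" for r p q z
    using split_at_most_one[of v r p q z] split_at_least_one[of v r p q] that nonadj vS by blast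
  obtain x x' where x: "adj v x" "adj v x'" "adj x z1" "adj x' z1" "x \<noteq> x'" "\<not> adj x x'"
    using Q_edge[of z1] vS dist by auto
  obtain y0 y0' where y0: "adj v y0" "adj v y0'" "adj y0 z2" "adj y0' z2" "y0 \<noteq> y0'" "\<not> adj y0 y0'"
    using Q_edge[of z2] vS dist by auto
  obtain c where c: "adj v c" "adj c z3" using Q_nonempty[of z3] vS dist by auto
  have off: "\<not> adj r z'" if "adj v r" "adj r z" "z \<in> S - {v}" "z' \<in> S - {v}" "z \<noteq> z'" for r z z'
    using Q_unique that by blast
  have zS: "z1 \<in> S - {v}" "z2 \<in> S - {v}" "z3 \<in> S - {v}" "z1 \<noteq> z2" "z1 \<noteq> z3" "z2 \<noteq> z3"
    using vS dist by auto
  have x_splits: "adj x y0 \<longleftrightarrow> \<not> adj x y0'"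
    by (rule split[where z = z1]; use x y0 zS off in blast)
  \<comment> \<open>Of \<open>y0\<close> and \<open>y0'\<close>, the one that misses
    \<open>x\<close> is called \<open>y\<close>.\<close>
  then obtain y y' where y: "adj v y" "adj v y'" "adj y z2" "adj y' z2" "y \<noteq> y'" "\<not> adj y y'"
    and xy: "\<not> adj x y" "adj x y'"
    using y0 adj_sym by blast
  have "adj x' y" "\<not> adj x' y'"
  proof -
    have "adj y x \<longleftrightarrow> \<not> adj y x'" "adj y' x \<longleftrightarrow> \<not> adj y' x'"
      by (rule split[where z = z2]; use x y zS off in blast)+
    with xy adj_sym show "adj x' y" "\<not> adj x' y'" by blast+
  qed
  \<comment> \<open>If \<open>z = z2\<close>, the nonadjacent pairs \<open>x y\<close>,
    \<open>y p\<close>, \<open>p q\<close>, \<open>q x'\<close>, \<open>x' x\<close> form a closed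
    walk of length five, along which adjacency to \<open>c\<close> would have to alternate.
    Otherwise \<open>q\<close> itself splits the pairs \<open>x x'\<close>, \<open>p y\<close> and
    \<open>x y\<close>, which is contradictory.\<close>
  have cross: False
    if x: "adj v x" "adj v x'" "adj x z1" "adj x' z1" "x \<noteq> x'" "\<not> adj x x'"
      and y: "adj v y" "adj y z2" "\<not> adj x y"
      and p: "adj v p" "adj p z1" "\<not> adj p y"
      and q: "adj v q" "adj q z" "z \<in> S - {v}" "z \<noteq> z1" "\<not> adj q x'" "\<not> adj p q"
    for x x' y p q z
  proof (cases "z = z2")
    case False
    have "adj q x \<longleftrightarrow> \<not> adj q x'" "adj q p \<longleftrightarrow> \<not> adj q y" "adj q x \<longleftrightarrow> \<not> adj q y"
      by (rule split[where z = z]; use x y p q zS off False in blast)+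
    then show False using q adj_sym by blast
  next
    case True
    have "adj c x \<longleftrightarrow> \<not> adj c y" "adj c p \<longleftrightarrow> \<not> adj c y" "adj c p \<longleftrightarrow> \<not> adj c q"
      "adj c q \<longleftrightarrow> \<not> adj c x'" "adj c x \<longleftrightarrow> \<not> adj c x'"
      by (rule split[where z = z3]; use x y p q c zS off True in blast)+
    then show False by blast
  qed
  \<comment> \<open>\<open>A\<close> and \<open>B\<close> are the two classes of a bipartition of
    the nonadjacency graph. The neighbours of \<open>z1\<close> are sorted by \<open>y\<close>,
    which sees \<open>z2\<close>; the others are sorted by \<open>x'\<close>, which sees
    \<open>z1\<close>. So the sorting vertex always splits the nonadjacent pairs on its
    side.\<close>
  define A where "A = {r. adj v r \<and> r \<notin> P \<and> (if adj r z1 then \<not> adj r y else \<not> adj r x')}"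
  define B where "B = {r. adj v r \<and> r \<notin> P \<and> (if adj r z1 then adj r y else adj r x')}"
  have Qz: "\<exists>z \<in> S - {v}. adj r z" if "adj v r" "r \<notin> P" for r
    using that adj_sym by (auto simp: P_def)
  have same: False if "adj v p" "p \<notin> P" "adj v q" "q \<notin> P" "adj p z1 \<longleftrightarrow> adj q z1"
      "\<not> adj p q" "p \<noteq> q"
      "if adj p z1 then adj p y \<longleftrightarrow> adj q y else adj p x' \<longleftrightarrow> adj q x'" for p q
  proof (cases "adj p z1")
    case True
    have "adj y p \<longleftrightarrow> \<not> adj y q"
      by (rule split[where z = z2]; use y that True off zS in blast)
    then show False using that True adj_sym by meson
  next
    case False
    have "adj x' p \<longleftrightarrow> \<not> adj x' q"
      by (rule split[where z = z1]; use x that False zS in blast)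
    then show False using that False adj_sym by meson
  qed
  have crossA: False if "p \<in> A" "q \<in> A" "adj p z1" "\<not> adj q z1" "\<not> adj p q" for p q
  proof -
    have p: "adj v p" "adj p z1" "\<not> adj p y" and q: "adj v q" "q \<notin> P" "\<not> adj q x'"
      using that by (auto simp: A_def)
    obtain z where z: "z \<in> S - {v}" "adj q z" using Qz q by blast
    have "z \<noteq> z1" using z that by blast
    show False
      by (rule cross[OF x y(1,3) xy(1) p q(1) z(2,1) \<open>z \<noteq> z1\<close> q(3)]) fact
  qed
  have crossB: False if "p \<in> B" "q \<in> B" "adj p z1" "\<not> adj q z1" "\<not> adj p q" for p q
  proof -
    have p: "adj v p" "adj p z1" "adj p y" and q: "adj v q" "q \<notin> P" "adj q x'"
      using that by (auto simp: B_def)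
    obtain z where z: "z \<in> S - {v}" "adj q z" using Qz q by blast
    have "z \<noteq> z1" using z that by blast
    \<comment> \<open>This prepares \<open>cross\<close> with \<open>x\<close> and \<open>x'\<close>
      exchanged and \<open>y'\<close> in place of \<open>y\<close>.\<close>
    have "adj p y \<longleftrightarrow> \<not> adj p y'"
      by (rule split[where z = z1]; use y p zS off in blast)
    moreover have "adj q x \<longleftrightarrow> \<not> adj q x'"
      by (rule split[where z = z]; use x q z \<open>z \<noteq> z1\<close> off zS in blast)
    ultimately have "\<not> adj p y'" "\<not> adj q x" using p q by blast+
    moreover have "\<not> adj x' x" using x adj_sym by blast
    ultimately show False
      using cross[OF x(2,1,4,3) x(5)[symmetric] _ y(2,4) \<open>\<not> adj x' y'\<close> p(1,2) _ q(1) z(2,1) \<open>z \<noteq> z1\<close>]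
        that(5) by blast
  qed
  have "clq A"
  proof (rule clqI)
    fix p q assume pq: "p \<in> A" "q \<in> A" "p \<noteq> q"
    show "adj p q"
      using same[of p q] crossA[of p q] crossA[of q p] adj_sym[of q p] pq
      by (cases "adj p z1"; cases "adj q z1") (auto simp: A_def)
  qed (use adj_V A_def in auto)
  moreover have "clq B"
  proof (rule clqI)
    fix p q assume pq: "p \<in> B" "q \<in> B" "p \<noteq> q"
    show "adj p q"
      using same[of p q] crossB[of p q] crossB[of q p] adj_sym[of q p] pq
      by (cases "adj p z1"; cases "adj q z1") (auto simp: B_def)
  qed (use adj_V B_def in auto)
  moreover have "nbrs v \<subseteq> P \<union> A \<union> B"
    by (auto simp: nbrs_def A_def B_def)
  ultimately show False using triI[OF vV P_clq] no_tri by blast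
qed

end

section \<open>Odd antiholes among the nonneighbours\<close>

text \<open>The antihole is indexed so that \<open>w i\<close> is nonadjacent to \<open>w (i + m)\<close> and \<open>w (i + m + 1)\<close> only, that
  is, in steps of two along the odd cycle formed by the complement. With this indexing the
  neighbours on the antihole of a neighbour of \<open>v\<close> are consecutive: \<open>arc k y\<close> says that they are
  \<open>w (k + 1), \<dots>, w (k + m)\<close>.\<close>

locale antihole_link = claw_free_graph +
  fixes v :: 'a and m n :: int and w :: "int \<Rightarrow> 'a"
  assumes m_ge: "m \<ge> 2" and n_def: "n = 2 * m + 1"
    and v_V: "v \<in> V"
    and w_cong: "i mod n = j mod n \<Longrightarrow> w i = w j"
    and w_v: "\<not> adj v (w i)" "w i \<noteq> v"
    and w_nonadj: "\<not> adj (w i) (w (i + m))" "w i \<noteq> w (i + m)"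
    and w_adj: "d mod n \<notin> {0, m, m + 1} \<Longrightarrow> adj (w i) (w (i + d))"
    and no_four: "\<lbrakk>adj v p; adj v q; p \<noteq> q\<rbrakk>
      \<Longrightarrow> adj p q \<or> adj p (w i) \<or> adj p (w (i + m)) \<or> adj q (w i) \<or> adj q (w (i + m))"
begin

section \<open>Arcs of the antihole seen by the neighbours of \<open>v\<close>\<close>

definition arc :: "int \<Rightarrow> 'a \<Rightarrow> bool" where
  "arc k y \<longleftrightarrow> adj v y \<and> (\<forall>j. adj y (w j) \<longleftrightarrow> (j - k - 1) mod n < m)"

definition off :: "'a \<Rightarrow> bool" where
  "off y \<longleftrightarrow> adj v y \<and> (\<forall>j. \<not> adj y (w j))"

lemma mod_bounds: "0 \<le> x mod n" "x mod n < n"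
  using m_ge n_def by (simp_all only: pos_mod_sign pos_mod_bound)

lemma mod_small: "\<lbrakk>0 \<le> r; r < n\<rbrakk> \<Longrightarrow> r mod n = r"
  by simp

lemma arc_adj: "\<lbrakk>arc k y; k < j; j \<le> k + m\<rbrakk> \<Longrightarrow> adj y (w j)"
  using mod_small[of "j - k - 1"] m_ge n_def unfolding arc_def by simp

lemma arc_nonadj: "\<lbrakk>arc k y; k + m < j; j \<le> k + n\<rbrakk> \<Longrightarrow> \<not> adj y (w j)"
  using mod_small[of "j - k - 1"] m_ge n_def unfolding arc_def by simp

text \<open>Adding \<open>n\<close> turns the indices \<open>k - m..k\<close> into
  \<open>k + m + 1..k + n\<close>, the complement of the arc.\<close>

lemma arc_nonadj':
  assumes "arc k y" "j \<le> k" "k \<le> j + m"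
  shows "\<not> adj y (w j)"
proof -
  have "w j = w (j + n)" by (rule w_cong) simp
  then show ?thesis using arc_nonadj[OF assms(1), of "j + n"] assms n_def by simp
qed

text \<open>Only the residue of \<open>k\<close> modulo \<open>n\<close> matters, so it can be
  chosen in any window of \<open>n\<close> consecutive integers.\<close>

lemma arc_rep:
  assumes "arc k y"
  obtains k' where "arc k' y" "c \<le> k'" "k' < c + n"
proof
  let ?k = "c + (k - c) mod n"
  have "(j - ?k - 1) mod n = (j - k - 1) mod n" for j
  proof -
    have "(j - ?k - 1) mod n = ((j - 1 - c) - (k - c) mod n) mod n" by (simp add: algebra_simps)
    also have "\<dots> = ((j - 1 - c) - (k - c)) mod n" by (rule mod_diff_right_eq)
    finally show ?thesis by (simp add: algebra_simps)
  qed
  then show "arc ?k y" using assms by (simp add: arc_def)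
  show "c \<le> ?k" "?k < c + n" using mod_bounds[of "k - c"] by auto
qed

text \<open>If \<open>y\<close> sees \<open>w i\<close>, then adjacency to \<open>y\<close>
  alternates along the complement cycle as long as the walk stays among neighbours of
  \<open>w i\<close>. This leaves one free bit, \<open>b 1\<close>, and either value of it gives an
  arc with \<open>w i\<close> at one end.\<close>

lemma arc_cases:
  assumes "adj v y"
  shows "off y \<or> (\<exists>k. arc k y)"
proof (cases "\<exists>i. adj y (w i)")
  case False
  then show ?thesis using assms by (simp add: off_def)
next
  case True
  then obtain i where i: "adj y (w i)" by blast
  define b where "b r \<longleftrightarrow> adj y (w (i + r))" for r
  have b_cong: "b r = b r'" if "r mod n = r' mod n" for r r'
    unfolding b_def using w_cong[of "i + r" "i + r'"] mod_add_cong[OF refl that] by metis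
  have b0: "b 0" using i by (simp add: b_def)
  \<comment> \<open>Otherwise there is a claw at \<open>y\<close> with leaf
    \<open>v\<close>.\<close>
  have not_both: "\<not> (b r \<and> b (r + m))" for r
    using claw_free[of y v "w (i + r)" "w (i + r + m)"] assms w_v w_nonadj[of "i + r"] adj_sym
    unfolding b_def by (metis add.assoc)
  \<comment> \<open>Otherwise there is a claw at \<open>w i\<close> with leaf \<open>y\<close>; the
    excluded residues are \<open>w i\<close> itself and its two nonneighbours.\<close>
  have one: "b r \<or> b (r + m)" if "r mod n \<notin> {0, m, m + 1}" "(r + m) mod n \<notin> {0, m, m + 1}" for r
  proof (rule ccontr)
    assume neg: "\<not> ?thesis"
    have "adj (w i) (w (i + r))" "adj (w i) (w (i + (r + m)))" by (rule w_adj; fact)+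
    moreover have "y \<noteq> w (i + r)" "y \<noteq> w (i + (r + m))" using assms w_v by blast+
    ultimately show False
      using claw_free[of "w i" y "w (i + r)" "w (i + (r + m))"] i adj_sym neg w_nonadj[of "i + r"]
      unfolding b_def by (metis add.assoc)
  qed
  have plus_n: "b (r + n) = b r" for r by (rule b_cong) simp
  have bm: "\<not> b m" using not_both[of 0] b0 by simp
  have bm1: "\<not> b (m + 1)" using not_both[of "m + 1"] b0 plus_n[of 0] n_def
    by (simp add: algebra_simps)
  have flip1: "b (r + m) \<longleftrightarrow> \<not> b r" if "2 \<le> r" "r \<le> m - 1" for r
    using one[of r] not_both[of r] that mod_small[of r] mod_small[of "r + m"] n_def by auto
  \<comment> \<open>Modulo \<open>n\<close>, a step of \<open>m + 1\<close> is a step of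
    \<open>m\<close> backwards.\<close>
  have flip2: "b (r + m + 1) \<longleftrightarrow> \<not> b r" if "1 \<le> r" "r \<le> m - 1" for r
  proof -
    have "(r + m + 1 + m) mod n = r mod n"
      using mod_add_self2[of r n] n_def by (simp add: algebra_simps)
    then show ?thesis
      using one[of "r + m + 1"] not_both[of "r + m + 1"] b_cong[of "r + m + 1 + m" r] that
        mod_small[of r] mod_small[of "r + m + 1"] n_def by auto
  qed
  have const: "r \<le> m - 1 \<longrightarrow> b r = b 1" if "1 \<le> r" for r
    using that
  proof (induction r rule: int_ge_induct)
    case (step r)
    then show ?case
      using flip1[of "r + 1"] flip2[of r] by (auto simp: algebra_simps)
  qed simp
  have upper: "b (r + m + 1) \<longleftrightarrow> \<not> b 1" if "1 \<le> r" "r \<le> m - 1" for r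
    using flip2[OF that] const[of r] that by simp
  \<comment> \<open>The window of offsets may start at any \<open>c\<close>; below it starts where
    the arc does, at \<open>0\<close> or at \<open>m + 2\<close>.\<close>
  have repr: "adj y (w j) = b (c + (j - i - c) mod n)" for j c
  proof -
    have "(c + (j - i - c) mod n) mod n = (c + (j - i - c)) mod n" by (rule mod_add_right_eq)
    then have "b (c + (j - i - c) mod n) = b (j - i)" by (intro b_cong) simp
    then show ?thesis by (simp add: b_def)
  qed
  show ?thesis
  proof (cases "b 1")
    case True
    have "b r \<longleftrightarrow> r < m" if r: "0 \<le> r" "r < n" for r
    proof -
      consider "r = 0" | "1 \<le> r \<and> r \<le> m - 1" | "r = m" | "r = m + 1" | "1 \<le> r - m - 1 \<and> r - m - 1 \<le> m - 1"
        using r n_def by linarith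
      then show ?thesis
        using b0 bm bm1 const[of r] upper[of "r - m - 1"] True m_ge by cases auto
    qed
    then have "arc (i - 1) y" unfolding arc_def using assms repr[of _ 0] mod_bounds by simp
    then show ?thesis by blast
  next
    case False
    have "b (m + 2 + r) \<longleftrightarrow> r < m" if r: "0 \<le> r" "r < n" for r
    proof -
      consider "r < m - 1" | "r = m - 1" | "1 \<le> r - m + 1 \<and> r - m + 1 \<le> m - 1" | "r = 2 * m - 1" | "r = 2 * m"
        using r n_def by linarith
      then show ?thesis
      proof cases
        case 1
        then show ?thesis using upper[of "r + 1"] False r by (simp add: algebra_simps)
      next
        case 2
        then have "m + 2 + r = 0 + n" using n_def by simp
        then have "b (m + 2 + r)" using plus_n[of 0] b0 by (simp only:)
        then show ?thesis using 2 by simp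
      next
        case 3
        then show ?thesis using plus_n[of "r - m + 1"] const[of "r - m + 1"] False n_def
          by (simp add: algebra_simps)
      next
        case 4
        then have "m + 2 + r = m + n" using n_def by simp
        then have "\<not> b (m + 2 + r)" using plus_n[of m] bm by metis
        then show ?thesis using 4 m_ge by simp
      next
        case 5
        then have "m + 2 + r = m + 1 + n" using n_def by simp
        then have "\<not> b (m + 2 + r)" using plus_n[of "m + 1"] bm1 by metis
        then show ?thesis using 5 m_ge by simp
      qed
    qed
    then have "adj y (w j) \<longleftrightarrow> (j - i - (m + 2)) mod n < m" for j
      unfolding repr[of j "m + 2"] using mod_bounds by blast
    then have "arc (i + m + 1) y" unfolding arc_def using assms by (simp add: diff_diff_eq add.assoc)
    then show ?thesis by blast
  qed
qed

text \<open>The two splitting lemmas with \<open>w i\<close> in the role of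
  \<open>z\<close>.\<close>

lemma split_arcs:
  assumes "arc a y" "arc b p" "arc c q" "\<not> adj p q" "p \<noteq> q"
    "a < i" "i \<le> a + m" "\<not> adj p (w i)" "\<not> adj q (w i)"
  shows "adj y p \<longleftrightarrow> \<not> adj y q"
proof -
  have "adj y (w i)" using arc_adj assms by blast
  moreover have "adj v y" "adj v p" "adj v q" using assms by (auto simp: arc_def)
  ultimately show ?thesis
    using split_at_most_one[of v y p q "w i"] split_at_least_one[of v y p q] w_v assms by blast
qed

text \<open>The two ends \<open>w (k + m + 1)\<close> and \<open>w (k + 2 * m + 1)\<close> of the
  stretch missed by an arc are nonadjacent. With nonadjacent \<open>y\<close> and \<open>p\<close>
  they would form a stable set of size four.\<close>

lemma off_adj:
  assumes "off y" "adj v p" "y \<noteq> p"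
  shows "adj y p"
proof (cases "off p")
  case True
  then show ?thesis using no_four[of y p 0] assms by (auto simp: off_def)
next
  case False
  then obtain k where k: "arc k p" using arc_cases assms by blast
  have "\<not> adj p (w (k + m + 1))" "\<not> adj p (w (k + m + 1 + m))"
    using arc_nonadj[OF k] m_ge n_def by auto
  then show ?thesis using no_four[of y p "k + m + 1"] assms by (auto simp: off_def)
qed

text \<open>Indices that belong to no vertex count towards the length \<open>l\<close> as
  well.\<close>

definition clq_arcs :: "int \<Rightarrow> int \<Rightarrow> bool" where
  "clq_arcs k l \<longleftrightarrow> (\<forall>y y' a b. arc a y \<and> arc b y' \<and> y \<noteq> y' \<and> k \<le> a \<and> a < k + l \<and> k \<le> b \<and> b < k + l
     \<longrightarrow> adj y y')"

text \<open>Two vertices with the same arc miss the same nonadjacent pair of the antihole, as in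
  \<open>off_adj\<close>.\<close>

lemma clq_arcs_1: "clq_arcs k 1"
  unfolding clq_arcs_def
proof (intro allI impI)
  fix y y' a b
  assume *: "arc a y \<and> arc b y' \<and> y \<noteq> y' \<and> k \<le> a \<and> a < k + 1 \<and> k \<le> b \<and> b < k + 1"
  then have "arc k y" "arc k y'" using order_antisym by force+
  then have "\<not> adj y (w (k + m + 1))" "\<not> adj y (w (k + m + 1 + m))"
    "\<not> adj y' (w (k + m + 1))" "\<not> adj y' (w (k + m + 1 + m))"
    using arc_nonadj m_ge n_def by auto
  then show "adj y y'" using no_four[of y y' "k + m + 1"] * by (auto simp: arc_def)
qed

text \<open>Let \<open>l\<close> be maximal such that some \<open>l\<close> consecutive arcs form a clique \<open>C\<close>, and let \<open>y \<in> C\<close>. The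
  neighbours of \<open>y\<close> outside \<open>C\<close> form a clique as well: two nonadjacent ones, with arcs \<open>j < k\<close>, would
  satisfy \<open>k - j > m\<close>, and then no vertex with arc in \<open>{k - m..j + m}\<close> is adjacent to \<open>y\<close>; so
  these arcs form a clique, and there are more than \<open>l\<close> of them.\<close>

lemma tri_v: "tri v"
proof -
  \<comment> \<open>The bound \<open>nat n\<close> makes a greatest length exist; \<open>n\<close>
    consecutive indices represent all arcs.\<close>
  let ?ok = "\<lambda>l. l \<le> nat n \<and> (\<exists>k. clq_arcs k (int l))"
  have "?ok 1" using clq_arcs_1 m_ge n_def by auto
  define l where "l = Greatest ?ok"
  have l: "?ok l"
    unfolding l_def by (rule GreatestI_nat[where P = ?ok, OF \<open>?ok 1\<close>, of "nat n"]) blast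
  have l_max: "l' \<le> l" if "?ok l'" for l'
    unfolding l_def by (rule Greatest_le_nat[where P = ?ok, OF that, of "nat n"]) blast
  obtain c where c: "clq_arcs c (int l)" using l by blast
  have l1: "int l \<ge> 1" using l_max[OF \<open>?ok 1\<close>] by simp
  define C where "C = {y. off y \<or> (\<exists>a. arc a y \<and> c \<le> a \<and> a < c + int l)}"
  have C_v: "adj v y" if "y \<in> C" for y using that by (auto simp: C_def arc_def off_def)
  have C_clq: "clq C"
  proof (rule clqI)
    fix p q assume pq: "p \<in> C" "q \<in> C" "p \<noteq> q"
    show "adj p q"
    proof (cases "off p \<or> off q")
      case True
      then show ?thesis using off_adj C_v pq adj_sym by blast
    next
      case False
      then show ?thesis using c pq unfolding clq_arcs_def C_def by blast
    qed
  qed (use C_v adj_V in blast)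
  have outC: "\<exists>j. arc j p \<and> c + int l \<le> j \<and> j < c + n" if "adj v p" "p \<notin> C" for p
  proof -
    from that arc_cases obtain k where "arc k p" by (auto simp: C_def)
    then obtain j where "arc j p" "c \<le> j" "j < c + n" using arc_rep[of k p c] by blast
    then show ?thesis using that by (force simp: C_def)
  qed
  show ?thesis
  proof (cases "\<exists>y a. arc a y \<and> c \<le> a \<and> a < c + int l")
    \<comment> \<open>A window without vertices can be lengthened by one index, so by maximality it
      has all \<open>n\<close> indices and \<open>C\<close> is the whole neighbourhood.\<close>
    case False
    have full: "int l = n"
    proof (rule ccontr)
      assume "int l \<noteq> n"
      then have "Suc l \<le> nat n" using conjunct1[OF l] m_ge n_def by linarith
      moreover have "clq_arcs c (int (Suc l))"
        unfolding clq_arcs_def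
      proof (intro allI impI)
        fix y y' a b
        assume *: "arc a y \<and> arc b y' \<and> y \<noteq> y' \<and> c \<le> a \<and> a < c + int (Suc l) \<and> c \<le> b \<and> b < c + int (Suc l)"
        then have "\<not> a < c + int l" "\<not> b < c + int l" using False by blast+
        with * have "a = c + int l" "b = c + int l" by auto
        with * clq_arcs_1[of "c + int l"] show "adj y y'" by (auto simp: clq_arcs_def)
      qed
      ultimately show False using l_max[of "Suc l"] by auto
    qed
    have "nbrs v \<subseteq> C"
      using outC full by (force simp: nbrs_def)
    then show ?thesis using triI[OF v_V C_clq C_clq C_clq] by simp
  next
    case True
    then obtain y a where y: "arc a y" "c \<le> a" "a < c + int l" by blast
    have y_v: "adj v y" using y by (simp add: arc_def)
    have key: False
      if p: "arc j p" "c + int l \<le> j" "adj y p" and q: "arc k q" "k < c + n" "adj y q"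
        and "j \<le> k" and pq: "p \<noteq> q" "\<not> adj p q" for j p k q
    proof (cases "k - j \<le> m")
      case True
      \<comment> \<open>\<open>w i\<close> lies on the arc of \<open>y\<close> and is missed by both
        \<open>p\<close> and \<open>q\<close>, so \<open>y\<close> cannot see both.\<close>
      define i where "i = min j (a + m)"
      have i: "a < i" "i \<le> a + m" "i \<le> j" "j \<le> i + m" "i \<le> k" "k \<le> i + m"
        using True y p q m_ge n_def \<open>j \<le> k\<close> by (auto simp: i_def)
      have "adj y p \<longleftrightarrow> \<not> adj y q"
        by (rule split_arcs[OF y(1) p(1) q(1) pq(2,1) i(1,2)
              arc_nonadj'[OF p(1) i(3,4)] arc_nonadj'[OF q(1) i(5,6)]])
      then show False using p q by blast
    next
      case False
      \<comment> \<open>\<open>w (j + m + 1)\<close> lies on the arc of \<open>r\<close> and is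
        missed by \<open>p\<close> and \<open>q\<close>, so \<open>r\<close> misses one of these
        two. That vertex and \<open>r\<close> both miss \<open>w j\<close> (for \<open>p\<close>) or
        \<open>w (k - m)\<close> (for \<open>q\<close>), which lies on the arc of \<open>y\<close>;
        as \<open>y\<close> sees that vertex, it misses \<open>r\<close>.\<close>
      have y_r: "\<not> adj y r \<and> y \<noteq> r" if r: "arc d r" "k - m \<le> d" "d \<le> j + m" for d r
      proof -
        have z: "d < j + m + 1" "j + m + 1 \<le> d + m" "j + m < j + m + 1" "j + m + 1 \<le> j + n"
          "j + m + 1 \<le> k" "k \<le> j + m + 1 + m"
          using r False m_ge n_def y p q by auto
        have nz: "\<not> adj p (w (j + m + 1))" "\<not> adj q (w (j + m + 1))"
          using arc_nonadj[OF p(1) z(3,4)] arc_nonadj'[OF q(1) z(5,6)] .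
        have "adj r (w (j + m + 1))" by (rule arc_adj[OF r(1) z(1,2)])
        with nz have "r \<noteq> p" "r \<noteq> q" by blast+
        have "adj r p \<longleftrightarrow> \<not> adj r q"
          by (rule split_arcs[OF r(1) p(1) q(1) pq(2,1) z(1,2) nz])
        then have "y \<noteq> r" using p q by blast
        from \<open>adj r p \<longleftrightarrow> \<not> adj r q\<close> consider "\<not> adj r p" | "\<not> adj r q" by blast
        then show ?thesis
        proof cases
          case 1
          have i: "a < j" "j \<le> a + m" "j \<le> d" "d \<le> j + m" "j \<le> j" "j \<le> j + m"
            using r False m_ge n_def y p q by auto
          have "adj y r \<longleftrightarrow> \<not> adj y p"
            by (rule split_arcs[OF y(1) r(1) p(1) 1 \<open>r \<noteq> p\<close> i(1,2)
                  arc_nonadj'[OF r(1) i(3,4)] arc_nonadj'[OF p(1) i(5,6)]])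
          then show ?thesis using p \<open>y \<noteq> r\<close> by blast
        next
          case 2
          have i: "a < k - m" "k - m \<le> a + m" "k - m \<le> d" "d \<le> k - m + m" "k - m \<le> k" "k \<le> k - m + m"
            using r False m_ge n_def y p q by auto
          have "adj y r \<longleftrightarrow> \<not> adj y q"
            by (rule split_arcs[OF y(1) r(1) q(1) 2 \<open>r \<noteq> q\<close> i(1,2)
                  arc_nonadj'[OF r(1) i(3,4)] arc_nonadj'[OF q(1) i(5,6)]])
          then show ?thesis using q \<open>y \<noteq> r\<close> by blast
        qed
      qed
      \<comment> \<open>The number of indices in \<open>{k - m..j + m}\<close>; it exceeds
        \<open>l\<close> because \<open>c + l \<le> j\<close> and \<open>k < c + n\<close>.\<close>
      define l' where "l' = nat (n - (k - j))"
      have l': "int l' = n - (k - j)" "l' \<le> nat n" "l < l'"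
        using p q \<open>j \<le> k\<close> l1 by (auto simp: l'_def)
      have "clq_arcs (k - m) (int l')"
        unfolding clq_arcs_def
      proof (intro allI impI)
        fix r s d e
        assume *: "arc d r \<and> arc e s \<and> r \<noteq> s \<and> k - m \<le> d \<and> d < k - m + int l' \<and> k - m \<le> e \<and> e < k - m + int l'"
        then have "d \<le> j + m" "e \<le> j + m" using l' n_def by auto
        with * y_r have "\<not> adj y r" "\<not> adj y s" "y \<noteq> r" "y \<noteq> s" by blast+
        then show "adj r s"
          using split_at_least_one[of v y r s] y_v * by (auto simp: arc_def)
      qed
      then show False using l_max[of l'] l' by auto
    qed
    have "clq {p. adj v p \<and> \<not> adj y p \<and> p \<noteq> y}"
    proof (rule clqI)
      fix p q assume "p \<in> {p. adj v p \<and> \<not> adj y p \<and> p \<noteq> y}"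
        "q \<in> {p. adj v p \<and> \<not> adj y p \<and> p \<noteq> y}" "p \<noteq> q"
      then show "adj p q" using split_at_least_one[of v y p q] y_v by blast
    qed (use adj_V in blast)
    moreover have "clq {p. adj v p \<and> p \<notin> C \<and> adj y p}"
    proof (rule clqI)
      fix p q assume pq: "p \<in> {p. adj v p \<and> p \<notin> C \<and> adj y p}"
        "q \<in> {p. adj v p \<and> p \<notin> C \<and> adj y p}" "p \<noteq> q"
      obtain j where j: "arc j p" "c + int l \<le> j" "j < c + n" using outC[of p] pq by blast
      obtain k where k: "arc k q" "c + int l \<le> k" "k < c + n" using outC[of q] pq by blast
      show "adj p q"
      proof (rule ccontr)
        assume "\<not> adj p q"
        then show False
          using key[OF j(1,2) _ k(1,3)] key[OF k(1,2) _ j(1,3)] pq adj_sym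
          by (cases "j \<le> k") auto
      qed
    qed (use adj_V in blast)
    moreover have "nbrs v \<subseteq> C \<union> {p. adj v p \<and> \<not> adj y p \<and> p \<noteq> y} \<union> {p. adj v p \<and> p \<notin> C \<and> adj y p}"
      using y by (auto simp: nbrs_def C_def)
    ultimately show ?thesis by (rule triI[OF v_V C_clq])
  qed
qed

end

section \<open>Odd closed walks and bipartitions\<close>

lemma relpow_sym:
  assumes "sym R" "(a, b) \<in> R ^^ k"
  shows "(b, a) \<in> R ^^ k"
  using assms(2)
proof (induction k arbitrary: b)
  case (Suc k)
  then obtain c where "(a, c) \<in> R ^^ k" "(c, b) \<in> R" by auto
  with Suc.IH[of c] show ?case
    using assms(1) relpow_Suc_I2[of b c R a k] by (auto dest: symD)
qed simp

text \<open>Each vertex is classified by the parity of its walks from the root of its component;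
  walks of both parities would close up to an odd walk.\<close>

lemma bipartition_if_no_odd_closed_walk:
  assumes "sym R" and even: "\<And>u k. (u, u) \<in> R ^^ k \<Longrightarrow> even k"
  obtains A where "\<And>a b. (a, b) \<in> R \<Longrightarrow> a \<in> A \<longleftrightarrow> b \<notin> A"
proof
  \<comment> \<open>The predicate under \<open>SOME\<close> is the same for all vertices of a
    component, so they share their root.\<close>
  define root where "root a = (SOME c. (c, a) \<in> R\<^sup>*)" for a
  define A where "A = {a. \<exists>k. even k \<and> (root a, a) \<in> R ^^ k}"
  have root: "(root a, a) \<in> R\<^sup>*" for a
    unfolding root_def by (rule someI[of _ a]) simp
  show "a \<in> A \<longleftrightarrow> b \<notin> A" if ab: "(a, b) \<in> R" for a b
  proof -
    have "(c, a) \<in> R\<^sup>* \<longleftrightarrow> (c, b) \<in> R\<^sup>*" for c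
      using ab symD[OF \<open>sym R\<close> ab] by (meson rtrancl.rtrancl_into_rtrancl)
    then have eq: "root a = root b" by (simp add: root_def)
    show ?thesis
    proof (cases "a \<in> A")
      case True
      then obtain k where k: "even k" "(root a, a) \<in> R ^^ k" by (auto simp: A_def)
      have "b \<notin> A"
      proof
        assume "b \<in> A"
        then obtain l where l: "even l" "(root b, b) \<in> R ^^ l" by (auto simp: A_def)
        have "(root a, b) \<in> R ^^ Suc k" using k ab by auto
        with relpow_sym[OF \<open>sym R\<close> l(2)] have "(root a, root a) \<in> R ^^ (Suc k + l)"
          unfolding relpow_add eq by blast
        with even k l show False by fastforce
      qed
      with True show ?thesis by blast
    next
      case False
      obtain k where k: "(root a, a) \<in> R ^^ k" using root rtrancl_imp_relpow by blast
      with False have "odd k" by (auto simp: A_def)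
      moreover have "(root b, b) \<in> R ^^ Suc k" using k ab eq by auto
      ultimately have "b \<in> A" unfolding A_def by (metis (mono_tags, lifting) even_Suc mem_Collect_eq)
      with False show ?thesis by blast
    qed
  qed
qed

text \<open>A shortest odd closed walk is an induced cycle: any shortcut splits it into two closed walks,
  exactly one of which is odd. The cases \<open>e = 0\<close> and \<open>e = 1\<close> of the last conclusion rule out
  repeated vertices and chords.\<close>

lemma shortest_odd_closed_walk:
  assumes "sym R" "(u, u) \<in> R ^^ k" "odd k"
  obtains n and g :: "int \<Rightarrow> 'a" where
    "odd n" "\<And>i. (g i, g (i + 1)) \<in> R"
    "\<And>i j. i mod int n = j mod int n \<Longrightarrow> g i = g j"
    "\<And>i d e. \<lbrakk>d \<le> n; (g i, g (i + int d)) \<in> R ^^ e\<rbrakk> \<Longrightarrow> d \<le> e \<or> n \<le> d + e"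
proof -
  let ?P = "\<lambda>n. odd n \<and> (\<exists>u. (u, u) \<in> R ^^ n)"
  define n where "n = (LEAST n. ?P n)"
  have "?P n" unfolding n_def by (rule LeastI[of ?P k]) (use assms in blast)
  then obtain u f where n: "odd n" and f: "f 0 = u" "f n = u" "\<And>i. i < n \<Longrightarrow> (f i, f (Suc i)) \<in> R"
    unfolding relpow_fun_conv by blast
  have least: "n \<le> l" if "(x, x) \<in> R ^^ l" "odd l" for x l
    unfolding n_def by (rule Least_le) (use that in blast)
  have n_pos: "n > 0" using n odd_pos by blast
  define g where "g i = f (nat (i mod int n))" for i
  have cong: "g i = g j" if "i mod int n = j mod int n" for i j
    using that by (simp add: g_def)
  have step: "(g i, g (i + 1)) \<in> R" for i
  proof -
    define r where "r = nat (i mod int n)"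
    have r: "i mod int n = int r" "r < n" using n_pos by (auto simp: r_def nat_less_iff)
    have "(i + 1) mod int n = (int r + 1) mod int n" using r by (metis mod_add_left_eq)
    moreover have "f (nat ((int r + 1) mod int n)) = f (Suc r)"
    proof (cases "Suc r = n")
      case True
      then have "int r + 1 = int n" by simp
      then have "nat ((int r + 1) mod int n) = 0" by (simp only: mod_self nat_0)
      then show ?thesis using f True by simp
    next
      case False
      then have "(int r + 1) mod int n = int (Suc r)" using r by (simp add: mod_pos_pos_trivial)
      then show ?thesis by (simp only: nat_int)
    qed
    ultimately show ?thesis using f(3)[OF r(2)] r(1) by (simp add: g_def)
  qed
  have walk: "(g i, g (i + int d)) \<in> R ^^ d" for i d
  proof (induction d)
    case (Suc d)
    then show ?case using step[of "i + int d"] by (auto simp: algebra_simps)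
  qed simp
  have "d \<le> e \<or> n \<le> d + e" if "d \<le> n" "(g i, g (i + int d)) \<in> R ^^ e" for i d e
  \<comment> \<open>For even \<open>d + e\<close>, replacing \<open>d\<close> steps by the shortcut
    leaves an odd closed walk; for odd \<open>d + e\<close>, the \<open>d\<close> steps and the
    shortcut form one.\<close>
  proof (cases "even (d + e)")
    case True
    have "g (i + int d + int (n - d)) = g i" using \<open>d \<le> n\<close> by (intro cong) (simp add: of_nat_diff)
    then have "(g (i + int d), g i) \<in> R ^^ (n - d)" using walk[of "i + int d" "n - d"] by simp
    with that(2) have "(g i, g i) \<in> R ^^ (e + (n - d))" unfolding relpow_add by blast
    moreover have "odd (e + (n - d))" using True n \<open>d \<le> n\<close> by (auto simp: even_diff_nat)
    ultimately show ?thesis using least \<open>d \<le> n\<close> by force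
  next
    case False
    have "(g i, g i) \<in> R ^^ (d + e)"
      unfolding relpow_add using walk relpow_sym[OF \<open>sym R\<close> that(2)] by blast
    then show ?thesis using least False by blast
  qed
  with that n step cong show ?thesis by blast
qed

section \<open>From uncoverable nonneighbours to an odd antihole\<close>

context claw_free_graph
begin

text \<open>\<open>M\<close> is not covered by two cliques, so nonadjacency on \<open>M\<close> is
  not bipartite. A shortest odd closed walk of nonadjacencies is an antihole, to which
  \<open>antihole_link\<close> applies.\<close>

lemma tri_if_not_two_cliques:
  assumes vV: "v \<in> V" and M: "M \<subseteq> V" "\<And>x. x \<in> M \<Longrightarrow> \<not> adj v x" "v \<notin> M"
    and no_cover: "\<And>K L. \<lbrakk>clq K; clq L\<rbrakk> \<Longrightarrow> M \<noteq> K \<union> L"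
    and no_four: "\<And>S. \<lbrakk>stable S; S \<subseteq> insert v (M \<union> nbrs v)\<rbrakk> \<Longrightarrow> card S \<noteq> 4"
  shows "tri v"
proof -
  define R where "R = {(a, b). a \<in> M \<and> b \<in> M \<and> a \<noteq> b \<and> \<not> adj a b}"
  have "sym R" using adj_sym by (auto simp: R_def sym_def)
  have "\<exists>u k. (u, u) \<in> R ^^ k \<and> odd k"
  proof (rule ccontr)
    assume "\<not> ?thesis"
    then obtain A where A: "\<And>a b. (a, b) \<in> R \<Longrightarrow> a \<in> A \<longleftrightarrow> b \<notin> A"
      using bipartition_if_no_odd_closed_walk[OF \<open>sym R\<close>] by metis
    have "clq (M \<inter> A)" "clq (M - A)"
      by (rule clqI; use A M(1) in \<open>auto simp: R_def\<close>)+
    with no_cover[of "M \<inter> A" "M - A"] show False by blast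
  qed
  then obtain n g where n: "odd n" and step: "\<And>i. (g i, g (i + 1)) \<in> R"
    and cong: "\<And>i j. i mod int n = j mod int n \<Longrightarrow> g i = g j"
    and short: "\<And>i d e. \<lbrakk>d \<le> n; (g i, g (i + int d)) \<in> R ^^ e\<rbrakk> \<Longrightarrow> d \<le> e \<or> n \<le> d + e"
    using shortest_odd_closed_walk[OF \<open>sym R\<close>] by metis
  have four: "adj a b \<or> adj a c \<or> adj a d \<or> adj b c \<or> adj b d \<or> adj c d"
    if "distinct [a, b, c, d]" "{a, b, c, d} \<subseteq> insert v (M \<union> nbrs v)" for a b c d
  proof (rule ccontr)
    assume "\<not> ?thesis"
    then have "stable {a, b, c, d}"
      using that vV M(1) adj_V adj_irrefl unfolding stable_def nbrs_def by (auto dest: adj_sym)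
    moreover have "card {a, b, c, d} = 4" using that by simp
    ultimately show False using no_four that by blast
  qed
  have gM: "g i \<in> M" for i using step[of i] by (auto simp: R_def)
  have g_nonadj: "\<not> adj (g i) (g (i + 1))" "g i \<noteq> g (i + 1)" for i
    using step[of i] by (auto simp: R_def)
  define m where "m = int n div 2"
  have nm: "int n = 2 * m + 1" using n by (auto simp: m_def elim: oddE)
  have "n \<noteq> 1"
  proof
    assume "n = 1"
    then have "g 0 = g (0 + 1)" by (intro cong) simp
    then show False using g_nonadj[of 0] by simp
  qed
  \<comment> \<open>Three pairwise nonadjacent vertices of \<open>M\<close> would form a stable set
    of size four with \<open>v\<close>.\<close>
  moreover have "n \<noteq> 3"
  proof
    assume "n = 3"
    then have "g 3 = g 0" by (intro cong) simp
    then have "\<not> adj (g 2) (g 0)" "g 2 \<noteq> g 0" using g_nonadj[of 2] by auto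
    moreover have "\<not> adj (g 0) (g 1)" "g 0 \<noteq> g 1" "\<not> adj (g 1) (g 2)" "g 1 \<noteq> g 2"
      using g_nonadj[of 0] g_nonadj[of 1] by auto
    moreover have "v \<noteq> g i" "\<not> adj v (g i)" for i using gM[of i] M by auto
    ultimately show False
      using four[of v "g 0" "g 1" "g 2"] gM adj_sym by auto
  qed
  ultimately have m_ge: "m \<ge> 2" using nm n by presburger
  have g_adj: "adj (g i) (g (i + d))" if "2 \<le> d" "d \<le> int n - 2" for i d
  proof -
    define d' where "d' = nat d"
    have d': "d = int d'" "2 \<le> d'" "d' + 2 \<le> n" using that by (auto simp: d'_def)
    have "\<not> (g i, g (i + d)) \<in> R ^^ 1" using short[of d' i 1] d' by auto
    moreover have "\<not> (g i, g (i + d)) \<in> R ^^ 0" using short[of d' i 0] d' by auto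
    ultimately show ?thesis using gM by (auto simp: R_def)
  qed
  \<comment> \<open>Since \<open>2 * m = n - 1\<close>, adding \<open>m\<close> to the index of
    \<open>g (2 * i)\<close> is one step back along the cycle \<open>g\<close>.\<close>
  interpret antihole_link V adj v m "int n" "\<lambda>i. g (2 * i)"
  proof
    show "g (2 * i) = g (2 * j)" if "i mod int n = j mod int n" for i j
      using that by (intro cong) (rule mod_mult_cong[OF refl])
    have prev: "g (2 * (i + m)) = g (2 * i - 1)" for i
    proof (rule cong)
      have eq: "2 * (i + m) = (2 * i - 1) + int n" using nm by simp
      show "2 * (i + m) mod int n = (2 * i - 1) mod int n"
        unfolding eq by (rule mod_add_self2)
    qed
    show nonadj: "\<not> adj (g (2 * i)) (g (2 * (i + m)))" "g (2 * i) \<noteq> g (2 * (i + m))" for i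
      using g_nonadj[of "2 * i - 1"] adj_sym unfolding prev by auto
    show "adj (g (2 * i)) (g (2 * (i + d)))" if d: "d mod int n \<notin> {0, m, m + 1}" for i d
    proof -
      define r where "r = d mod int n"
      have r: "0 \<le> r" "r < int n" "r \<noteq> 0" "r \<noteq> m" "r \<noteq> m + 1" using d n odd_pos[of n] by (auto simp: r_def)
      \<comment> \<open>The representative of \<open>2 * r\<close> modulo \<open>n\<close> in the
        range where \<open>g_adj\<close> applies.\<close>
      define e where "e = (if r \<le> m then 2 * r else 2 * r - int n)"
      have "(2 * (i + d)) mod int n = (2 * i + 2 * r) mod int n"
        using mod_add_cong[OF refl mod_mult_right_eq[of 2 d "int n", symmetric], of "2 * i"]
        unfolding r_def by (simp only: distrib_left)
      also have "\<dots> = (2 * i + e) mod int n"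
        unfolding e_def by (auto simp: algebra_simps) 
      finally have "g (2 * (i + d)) = g (2 * i + e)" by (rule cong)
      moreover have "2 \<le> e" "e \<le> int n - 2" using r nm by (auto simp: e_def)
      ultimately show ?thesis using g_adj by metis
    qed
    show "adj p q \<or> adj p (g (2 * i)) \<or> adj p (g (2 * (i + m))) \<or> adj q (g (2 * i)) \<or> adj q (g (2 * (i + m)))"
      if "adj v p" "adj v q" "p \<noteq> q" for p q i
    proof -
      have "p \<noteq> g j" "q \<noteq> g j" for j using gM[of j] M that by auto
      then show ?thesis
        using four[of p q "g (2 * i)" "g (2 * (i + m))"] that gM nonadj[of i] by (auto simp: nbrs_def)
    qed
  qed (use m_ge nm vV M gM in auto)
  show ?thesis by (rule tri_v)
qed

end

section \<open>Perfection and divisions\<close>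

lemma vertices_induced [simp]: "vertices (induced G X) = X"
  by (simp add: induced_def)

lemma induced_induced: "A \<subseteq> X \<Longrightarrow> induced (induced G X) A = induced G A"
  by (auto simp: induced_def)

lemma graph_clique_induced:
  "graph_clique (induced G X) K \<longleftrightarrow> K \<subseteq> X \<and> clique K (edges G)"
  by (auto simp: graph_clique_def induced_def clique_def)

lemma fin_simple_graph_edgeD:
  assumes "fin_simple_graph G" "{u, v} \<in> edges G"
  shows "u \<noteq> v" "u \<in> vertices G" "v \<in> vertices G"
proof -
  have "{u, v} \<subseteq> vertices G" "card {u, v} = 2"
    using assms unfolding fin_simple_graph_def nsets_def by blast+
  then show "u \<noteq> v" "u \<in> vertices G" "v \<in> vertices G" by auto
qed

lemma fin_simple_graph_no_loop: "fin_simple_graph G \<Longrightarrow> {x} \<notin> edges G"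
  using fin_simple_graph_edgeD(1)[of G x x] by auto

lemma fin_simple_graph_finite: "\<lbrakk>fin_simple_graph G; X \<subseteq> vertices G\<rbrakk> \<Longrightarrow> finite X"
  by (auto simp: fin_simple_graph_def dest: finite_subset)

lemma finite_clique_cards:
  assumes "finite (vertices H)"
  shows "finite {card K | K. graph_clique H K}"
proof -
  have "{card K | K. graph_clique H K} \<subseteq> card ` Pow (vertices H)"
    by (auto simp: graph_clique_def)
  then show ?thesis by (rule finite_subset) (use assms in simp)
qed

lemma card_le_clique_number:
  "\<lbrakk>finite (vertices H); graph_clique H K\<rbrakk> \<Longrightarrow> card K \<le> clique_number H"
  unfolding clique_number_def by (rule Max_ge[OF finite_clique_cards]) auto

lemma clique_number_attained:
  assumes "finite (vertices H)"
  obtains K where "graph_clique H K" "card K = clique_number H"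
proof -
  have "graph_clique H {}" by (simp add: graph_clique_def clique_def)
  then have "clique_number H \<in> {card K | K. graph_clique H K}"
    unfolding clique_number_def by (intro Max_in finite_clique_cards assms) blast
  then show ?thesis using that by auto
qed

lemma clique_number_mono:
  assumes "finite Y" "X \<subseteq> Y"
  shows "clique_number (induced G X) \<le> clique_number (induced G Y)"
proof -
  have "finite X" using assms finite_subset by blast
  then obtain K where "graph_clique (induced G X) K" "card K = clique_number (induced G X)"
    using clique_number_attained[of "induced G X"] by auto
  then show ?thesis
    using card_le_clique_number[of "induced G Y" K] assms by (auto simp: graph_clique_induced)
qed

section \<open>Colourings and perfect induced subgraphs\<close>

definition colourable :: "'a ugraph \<Rightarrow> 'a set \<Rightarrow> nat \<Rightarrow> bool" where
  "colourable G X k \<longleftrightarrow> (\<exists>c. colouring (induced G X) k c)"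

lemma colourable_iff:
  "colourable G X k \<longleftrightarrow>
    (\<exists>c. (\<forall>v\<in>X. c v < k) \<and> (\<forall>u\<in>X. \<forall>v\<in>X. {u, v} \<in> edges G \<longrightarrow> c u \<noteq> c v))"
  by (auto simp: colourable_def colouring_def induced_def)

lemma colourable_mono: "\<lbrakk>colourable G X k; k \<le> l\<rbrakk> \<Longrightarrow> colourable G X l"
  unfolding colourable_iff by (meson order_less_le_trans)

lemma colourable_Un:
  assumes "colourable G X k" "colourable G Y l"
  shows "colourable G (X \<union> Y) (k + l)"
proof -
  obtain c where c: "\<forall>v\<in>X. c v < k" "\<forall>u\<in>X. \<forall>v\<in>X. {u, v} \<in> edges G \<longrightarrow> c u \<noteq> c v"
    using assms(1) unfolding colourable_iff by auto
  obtain d where d: "\<forall>v\<in>Y. d v < l" "\<forall>u\<in>Y. \<forall>v\<in>Y. {u, v} \<in> edges G \<longrightarrow> d u \<noteq> d v"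
    using assms(2) unfolding colourable_iff by auto
  show ?thesis
    unfolding colourable_iff
    by (rule exI[of _ "\<lambda>v. if v \<in> X then c v else k + d v"]) (use c d in force)
qed

lemma colourable_Un_anticomplete:
  assumes "colourable G X k" "colourable G Y k"
    and "\<And>x y. \<lbrakk>x \<in> X; y \<in> Y\<rbrakk> \<Longrightarrow> {x, y} \<notin> edges G"
  shows "colourable G (X \<union> Y) k"
proof -
  obtain c where c: "\<forall>v\<in>X. c v < k" "\<forall>u\<in>X. \<forall>v\<in>X. {u, v} \<in> edges G \<longrightarrow> c u \<noteq> c v"
    using assms(1) unfolding colourable_iff by auto
  obtain d where d: "\<forall>v\<in>Y. d v < k" "\<forall>u\<in>Y. \<forall>v\<in>Y. {u, v} \<in> edges G \<longrightarrow> d u \<noteq> d v"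
    using assms(2) unfolding colourable_iff by auto
  have "{y, x} \<notin> edges G" if "x \<in> X" "y \<in> Y" for x y
    using assms(3)[OF that] by (simp add: insert_commute)
  with assms(3) show ?thesis
    unfolding colourable_iff
    by (intro exI[of _ "\<lambda>v. if v \<in> X then c v else d v"]) (use c d in auto)
qed

lemma colourable_card:
  assumes "fin_simple_graph G" "finite X"
  shows "colourable G X (card X)"
proof -
  obtain h where h: "bij_betw h X {0..<card X}" using ex_bij_betw_finite_nat assms by blast
  then have "h u \<noteq> h v" if "u \<in> X" "v \<in> X" "{u, v} \<in> edges G" for u v
    using fin_simple_graph_edgeD(1)[OF assms(1) that(3)] that by (auto simp: bij_betw_def dest: inj_onD)
  moreover have "h v < card X" if "v \<in> X" for v
    using h that by (auto simp: bij_betw_def)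
  ultimately show ?thesis unfolding colourable_iff by blast
qed

lemma clique_le_colours:
  assumes "colourable G X k" "K \<subseteq> X" "clique K (edges G)"
  shows "card K \<le> k"
proof -
  obtain c where c: "\<forall>v\<in>X. c v < k" "\<forall>u\<in>X. \<forall>v\<in>X. {u, v} \<in> edges G \<longrightarrow> c u \<noteq> c v"
    using assms unfolding colourable_iff by blast
  have "inj_on c K"
  proof (rule inj_onI, rule ccontr)
    fix x y assume "x \<in> K" "y \<in> K" "c x = c y" "x \<noteq> y"
    with c(2) assms show False unfolding clique_def by blast
  qed
  moreover have "c ` K \<subseteq> {..<k}" using c assms by auto
  ultimately have "card K \<le> card {..<k}" by (intro card_inj_on_le) auto
  then show ?thesis by simp
qed

text \<open>A clique needs as many colours as it has vertices, so only the upper bound on the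
  chromatic number is a condition.\<close>

lemma perfect_induced_iff:
  assumes "fin_simple_graph G" "A \<subseteq> vertices G"
  shows "perfect (induced G A) \<longleftrightarrow> (\<forall>X\<subseteq>A. colourable G X (clique_number (induced G X)))"
proof -
  have "chromatic_number (induced G X) = clique_number (induced G X) \<longleftrightarrow>
      colourable G X (clique_number (induced G X))" if "X \<subseteq> A" for X
  proof
    have fin: "finite X" using fin_simple_graph_finite assms that by blast
    then have "colourable G X (chromatic_number (induced G X))"
      unfolding chromatic_number_def colourable_def[symmetric]
      using colourable_card[OF assms(1) fin] by (rule_tac LeastI)
    then show "colourable G X (clique_number (induced G X))"
      if "chromatic_number (induced G X) = clique_number (induced G X)"
      using that by simp
    obtain K where K: "graph_clique (induced G X) K" "card K = clique_number (induced G X)"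
      using clique_number_attained[of "induced G X"] fin by auto
    show "chromatic_number (induced G X) = clique_number (induced G X)"
      if "colourable G X (clique_number (induced G X))"
      unfolding chromatic_number_def colourable_def[symmetric]
      by (rule Least_equality[where P = "colourable G X", OF that]) (use K clique_le_colours graph_clique_induced in metis)
  qed
  then show ?thesis unfolding perfect_def using induced_induced[of _ A G] by auto
qed

text \<open>Both sides can use the same colours, as many as the clique number of the whole of
  \<open>X\<close>.\<close>

lemma perfect_Un_anticomplete:
  assumes G: "fin_simple_graph G" "A \<subseteq> vertices G" "B \<subseteq> vertices G"
    and "perfect (induced G A)" "perfect (induced G B)"
    and anti: "\<And>x y. \<lbrakk>x \<in> A; y \<in> B\<rbrakk> \<Longrightarrow> {x, y} \<notin> edges G"
  shows "perfect (induced G (A \<union> B))"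
proof -
  have "colourable G X (clique_number (induced G X))" if X: "X \<subseteq> A \<union> B" for X
  proof -
    have fin: "finite X" using fin_simple_graph_finite[OF G(1), of X] X G by blast
    have "colourable G (X \<inter> C) (clique_number (induced G X))" if C: "C \<subseteq> vertices G" "perfect (induced G C)" for C
    proof (rule colourable_mono)
      show "colourable G (X \<inter> C) (clique_number (induced G (X \<inter> C)))"
        using perfect_induced_iff[OF G(1)] C by blast
    qed (use clique_number_mono fin in blast)
    then have "colourable G (X \<inter> A \<union> X \<inter> B) (clique_number (induced G X))"
      using assms by (intro colourable_Un_anticomplete) auto
    moreover have "X \<inter> A \<union> X \<inter> B = X" using X by blast
    ultimately show ?thesis by simp
  qed
  then show ?thesis using perfect_induced_iff[OF G(1)] G by auto
qed

lemma clique_Un: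
  assumes "clique A E" "clique B E"
    and "\<And>a b. \<lbrakk>a \<in> A; b \<in> B; a \<noteq> b\<rbrakk> \<Longrightarrow> {a, b} \<in> E"
  shows "clique (A \<union> B) E"
proof -
  have "{b, a} \<in> E" if "a \<in> A" "b \<in> B" "a \<noteq> b" for a b
    using assms(3)[OF that] by (simp add: insert_commute)
  with assms show ?thesis unfolding clique_def by blast
qed

lemma clique_subset: "\<lbrakk>clique B E; A \<subseteq> B\<rbrakk> \<Longrightarrow> clique A E"
  by (auto simp: clique_def)

text \<open>Koenig's theorem for the bipartite complement. If a clique of size \<open>k\<close> other than \<open>K\<close> and
  \<open>L\<close> consists of \<open>K1 \<subseteq> K\<close> and \<open>L1 \<subseteq> L\<close>, then \<open>K1 \<union> (L - L1)\<close> and \<open>(K - K1) \<union> L1\<close> are coloured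
  separately with \<open>card K1\<close> and \<open>card L1\<close> colours; otherwise a nonadjacent pair is a colour class.\<close>

lemma colourable_two_cliques:
  assumes G: "fin_simple_graph G"
    and "finite K" "finite L" "K \<inter> L = {}" "clique K (edges G)" "clique L (edges G)"
    and "\<And>Z. \<lbrakk>Z \<subseteq> K \<union> L; clique Z (edges G)\<rbrakk> \<Longrightarrow> card Z \<le> k"
  shows "colourable G (K \<union> L) k"
  using assms(2-)
proof (induction "card (K \<union> L)" arbitrary: K L k rule: less_induct)
  case less
  note fin = less.prems(1,2) and disj = less.prems(3) and K = less.prems(4) and L = less.prems(5)
    and bound = less.prems(6)
  have finKL: "finite (K \<union> L)" using fin by simp
  show ?case
  \<comment> \<open>The two excluded pairs are those for which one of the two smaller sets would be
    all of \<open>K \<union> L\<close>.\<close>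
  proof (cases "\<exists>K1 L1. K1 \<subseteq> K \<and> L1 \<subseteq> L \<and> clique (K1 \<union> L1) (edges G) \<and> card (K1 \<union> L1) = k \<and>
      \<not> (K1 = K \<and> L1 = {}) \<and> \<not> (K1 = {} \<and> L1 = L)")
    case True
    then obtain K1 L1 where sub: "K1 \<subseteq> K" "L1 \<subseteq> L" and KL1: "clique (K1 \<union> L1) (edges G)"
      "card (K1 \<union> L1) = k" and proper: "\<not> (K1 = K \<and> L1 = {})" "\<not> (K1 = {} \<and> L1 = L)"
      by blast
    have fin1: "finite K1" "finite L1" using sub fin finite_subset by blast+
    have k: "k = card K1 + card L1"
      using KL1(2) card_Un_disjoint[OF fin1] sub disj by force
    have "colourable G (K1 \<union> (L - L1)) (card K1)"
    proof (rule less.hyps)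
      show "card (K1 \<union> (L - L1)) < card (K \<union> L)"
        by (rule psubset_card_mono[OF finKL]) (use sub proper disj in blast)
      \<comment> \<open>\<open>Z\<close> extends by \<open>L1\<close> to a clique: \<open>K1\<close>
        is complete to \<open>L1\<close>, and the rest of \<open>Z\<close> lies in
        \<open>L\<close>.\<close>
      show "card Z \<le> card K1" if Z: "Z \<subseteq> K1 \<union> (L - L1)" "clique Z (edges G)" for Z
      proof -
        have "clique (Z \<union> L1) (edges G)"
          by (rule clique_Un[OF Z(2) clique_subset[OF L sub(2)]])
            (use Z KL1(1) L sub in \<open>unfold clique_def, blast\<close>)
        then have "card (Z \<union> L1) \<le> k" by (intro bound) (use Z sub in auto)
        moreover have "card (Z \<union> L1) = card Z + card L1"
          by (rule card_Un_disjoint) (use Z sub disj fin fin1 finite_subset[OF Z(1)] in auto)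
        ultimately show ?thesis using k by simp
      qed
    qed (use sub fin fin1 disj clique_subset[OF K] clique_subset[OF L] in auto)
    moreover have "colourable G ((K - K1) \<union> L1) (card L1)"
    proof (rule less.hyps)
      show "card ((K - K1) \<union> L1) < card (K \<union> L)"
        by (rule psubset_card_mono[OF finKL]) (use sub proper disj in blast)
      show "card Z \<le> card L1" if Z: "Z \<subseteq> (K - K1) \<union> L1" "clique Z (edges G)" for Z
      proof -
        have "clique (Z \<union> K1) (edges G)"
          by (rule clique_Un[OF Z(2) clique_subset[OF K sub(1)]])
            (use Z KL1(1) K sub in \<open>unfold clique_def, blast\<close>)
        then have "card (Z \<union> K1) \<le> k" by (intro bound) (use Z sub in auto)
        moreover have "card (Z \<union> K1) = card Z + card K1"
          by (rule card_Un_disjoint) (use Z sub disj fin fin1 finite_subset[OF Z(1)] in auto)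
        ultimately show ?thesis using k by simp
      qed
    qed (use sub fin fin1 disj clique_subset[OF K] clique_subset[OF L] in auto)
    ultimately have "colourable G (K1 \<union> (L - L1) \<union> ((K - K1) \<union> L1)) k"
      unfolding k by (rule colourable_Un)
    moreover have "K1 \<union> (L - L1) \<union> ((K - K1) \<union> L1) = K \<union> L" using sub by blast
    ultimately show ?thesis by simp
  next
    case False
    show ?thesis
    proof (cases "clique (K \<union> L) (edges G)")
      case True
      then show ?thesis
        using colourable_mono[OF colourable_card[OF G finKL]] bound by blast
    next
      case nonclique: False
      then obtain x y where xy: "x \<in> K" "y \<in> L" "{x, y} \<notin> edges G"
        using clique_Un[OF K L] by blast
      have "colourable G ((K - {x}) \<union> (L - {y})) (k - 1)"
      proof (rule less.hyps)
        show "card (K - {x} \<union> (L - {y})) < card (K \<union> L)"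
          by (rule psubset_card_mono[OF finKL]) (use xy disj in blast)
        \<comment> \<open>A clique of size \<open>k\<close> that avoids \<open>x\<close> and
          \<open>y\<close> is neither \<open>K\<close> nor \<open>L\<close>, so it belongs to the
          case already treated.\<close>
        show "card Z \<le> k - 1" if Z: "Z \<subseteq> (K - {x}) \<union> (L - {y})" "clique Z (edges G)" for Z
        proof -
          have "Z = (Z \<inter> K) \<union> (Z \<inter> L)" using Z by blast
          moreover have "Z \<inter> K \<noteq> K" "Z \<inter> L \<noteq> L" using xy Z disj by blast+
          ultimately have "card Z \<noteq> k" using False Z by (metis inf_le2)
          moreover have "card Z \<le> k" by (rule bound) (use Z in auto)
          ultimately show ?thesis by simp
        qed
      qed (use fin disj clique_subset[OF K] clique_subset[OF L] in auto)
      moreover have "colourable G {x, y} 1"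
        unfolding colourable_iff
        by (rule exI[of _ "\<lambda>_. 0"])
          (use xy fin_simple_graph_no_loop[OF G] in \<open>auto simp: insert_commute\<close>)
      ultimately have "colourable G ((K - {x}) \<union> (L - {y}) \<union> {x, y}) (k - 1 + 1)"
        by (rule colourable_Un)
      moreover have "(K - {x}) \<union> (L - {y}) \<union> {x, y} = K \<union> L" using xy by blast
      moreover have "k \<ge> 1" using bound[of "{x}"] xy by (auto simp: clique_def)
      ultimately show ?thesis by simp
    qed
  qed
qed

lemma perfect_two_cliques:
  assumes G: "fin_simple_graph G" and "graph_clique G K" "graph_clique G L"
  shows "perfect (induced G (K \<union> L))"
proof -
  have "colourable G X (clique_number (induced G X))" if X: "X \<subseteq> K \<union> L" for X
  proof -
    have fin: "finite X" using fin_simple_graph_finite[OF G, of X] X assms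
      by (auto simp: graph_clique_def)
    have "colourable G ((X \<inter> K) \<union> (X - K)) (clique_number (induced G X))"
    proof (rule colourable_two_cliques[OF G])
      show "clique (X \<inter> K) (edges G)" "clique (X - K) (edges G)"
        using X assms clique_subset[of K "edges G" "X \<inter> K"] clique_subset[of L "edges G" "X - K"]
        by (auto simp: graph_clique_def)
      show "card Z \<le> clique_number (induced G X)"
        if "Z \<subseteq> X \<inter> K \<union> (X - K)" "clique Z (edges G)" for Z
        using that fin by (intro card_le_clique_number) (auto simp: graph_clique_induced)
    qed (use fin in auto)
    moreover have "(X \<inter> K) \<union> (X - K) = X" by blast
    ultimately show ?thesis by simp
  qed
  then show ?thesis
    using perfect_induced_iff[OF G, of "K \<union> L"] assms by (auto simp: graph_clique_def)
qed

section \<open>Divisions of vertex sets\<close>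

definition divisible :: "'a ugraph \<Rightarrow> 'a set \<Rightarrow> bool" where
  "divisible G X \<longleftrightarrow> (\<exists>A B. A \<union> B = X \<and> A \<inter> B = {} \<and> perfect (induced G A) \<and>
     clique_number (induced G B) < clique_number (induced G X))"

lemma perfectly_divisible_iff:
  "perfectly_divisible G \<longleftrightarrow> (\<forall>X \<subseteq> vertices G. X \<noteq> {} \<longrightarrow> divisible G X)"
proof -
  have "(let H = induced G X in \<exists>A B. A \<union> B = vertices H \<and> A \<inter> B = {} \<and>
      perfect (induced H A) \<and> clique_number (induced H B) < clique_number H) \<longleftrightarrow> divisible G X" for X
    unfolding divisible_def Let_def vertices_induced
    by (intro ex_cong1 conj_cong refl) (auto simp: induced_induced)
  then show ?thesis by (simp add: perfectly_divisible_def)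
qed

text \<open>A clique never meets both sides, so the two divisions combine. This puts a minimal
  indivisible set into one component.\<close>

lemma divisible_Un_anticomplete:
  assumes G: "fin_simple_graph G" "X \<subseteq> vertices G" "Y \<subseteq> vertices G" "X \<inter> Y = {}"
    and "divisible G X" "divisible G Y"
    and anti: "\<And>x y. \<lbrakk>x \<in> X; y \<in> Y\<rbrakk> \<Longrightarrow> {x, y} \<notin> edges G"
  shows "divisible G (X \<union> Y)"
proof -
  obtain A B where AB: "A \<union> B = X" "A \<inter> B = {}" "perfect (induced G A)"
    "clique_number (induced G B) < clique_number (induced G X)"
    using assms by (auto simp: divisible_def)
  obtain C D where CD: "C \<union> D = Y" "C \<inter> D = {}" "perfect (induced G C)"
    "clique_number (induced G D) < clique_number (induced G Y)"
    using assms by (auto simp: divisible_def)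
  have fin: "finite (X \<union> Y)" using fin_simple_graph_finite[OF G(1)] G by simp
  have "perfect (induced G (A \<union> C))"
    by (rule perfect_Un_anticomplete[OF G(1)]) (use AB CD G anti in auto)
  moreover have "clique_number (induced G (B \<union> D)) < clique_number (induced G (X \<union> Y))"
  proof -
    have finBD: "finite (B \<union> D)" using fin AB CD by (auto dest: finite_subset)
    then obtain Z where Z: "graph_clique (induced G (B \<union> D)) Z" "card Z = clique_number (induced G (B \<union> D))"
      using clique_number_attained[of "induced G (B \<union> D)"] by auto
    have "Z \<subseteq> B \<or> Z \<subseteq> D"
    proof (rule ccontr)
      assume "\<not> ?thesis"
      then obtain b d where "b \<in> Z" "b \<in> B" "d \<in> Z" "d \<in> D" using Z by (auto simp: graph_clique_induced)
      moreover from this have "b \<noteq> d" using AB CD G by blast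
      ultimately show False using anti[of b d] Z AB CD by (auto simp: graph_clique_induced clique_def)
    qed
    then have "card Z \<le> clique_number (induced G B) \<or> card Z \<le> clique_number (induced G D)"
      using card_le_clique_number[of "induced G B" Z] card_le_clique_number[of "induced G D" Z] Z finBD
      by (auto simp: graph_clique_induced)
    moreover have "clique_number (induced G X) \<le> clique_number (induced G (X \<union> Y))"
      "clique_number (induced G Y) \<le> clique_number (induced G (X \<union> Y))"
      by (rule clique_number_mono[OF fin]; blast)+
    ultimately show ?thesis using AB CD Z by linarith
  qed
  moreover have "(A \<union> C) \<union> (B \<union> D) = X \<union> Y" "(A \<union> C) \<inter> (B \<union> D) = {}" using AB CD G by blast+
  ultimately show ?thesis unfolding divisible_def by blast
qed

section \<open>Trisimplicial vertices\<close>

lemma contains_claw: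
  assumes G: "fin_simple_graph G"
    and adj: "{c, x} \<in> edges G" "{c, y} \<in> edges G" "{c, z} \<in> edges G"
    and dist: "x \<noteq> y" "x \<noteq> z" "y \<noteq> z"
    and nonadj: "{x, y} \<notin> edges G" "{x, z} \<notin> edges G" "{y, z} \<notin> edges G"
  shows "contains_induced G claw"
proof -
  let ?X = "{c, x, y, z}"
  define f :: "nat + nat \<Rightarrow> _" where
    "f s = (case s of Inl _ \<Rightarrow> c | Inr i \<Rightarrow> if i = 0 then x else if i = 1 then y else z)" for s
  have ends: "c \<noteq> x" "c \<noteq> y" "c \<noteq> z" "?X \<subseteq> vertices G"
    using fin_simple_graph_edgeD[OF G] adj by blast+
  have V: "vertices claw = {Inl 0, Inr 0, Inr 1, Inr 2}"
    by (auto simp: claw_def complete_bipartite_def)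
  have "edges claw = (\<lambda>j. {Inl 0, Inr j}) ` {..<3}"
    by (auto simp: claw_def complete_bipartite_def)
  also have "{..<3} = {0, 1, 2 :: nat}" by auto
  finally have E: "edges claw = {{Inl 0, Inr 0}, {Inl 0, Inr 1}, {Inl 0, Inr 2}}" by simp
  have "bij_betw f (vertices claw) ?X"
    unfolding V by (rule bij_betwI') (use ends dist in \<open>auto simp: f_def\<close>)
  moreover have "{e \<in> edges G. e \<subseteq> ?X} = {{c, x}, {c, y}, {c, z}}"
  proof
    show "{e \<in> edges G. e \<subseteq> ?X} \<subseteq> {{c, x}, {c, y}, {c, z}}"
    proof
      fix e assume e: "e \<in> {e \<in> edges G. e \<subseteq> ?X}"
      then have "card e = 2" using G unfolding fin_simple_graph_def nsets_def by blast
      then obtain a b where "e = {a, b}" "a \<noteq> b" by (auto simp: card_2_iff)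
      then show "e \<in> {{c, x}, {c, y}, {c, z}}"
        using e nonadj by (auto simp: insert_commute)
    qed
  qed (use adj in auto)
  then have "edges (induced G ?X) = (\<lambda>e. f ` e) ` edges claw"
    by (simp add: E induced_def f_def)
  ultimately have "graph_iso claw (induced G ?X)"
    unfolding graph_iso_def by auto
  then show ?thesis using ends unfolding contains_induced_def by blast
qed

lemma claw_free_graphI:
  assumes G: "fin_simple_graph G" and "\<not> contains_induced G claw"
  shows "claw_free_graph (vertices G) (\<lambda>u v. {u, v} \<in> edges G)"
proof
  show "finite (vertices G)" using G by (simp add: fin_simple_graph_def)
  show "x \<in> vertices G \<and> y \<in> vertices G" if "{x, y} \<in> edges G" for x y
    using fin_simple_graph_edgeD[OF G that] by blast
  show "{x, x} \<notin> edges G" for x using fin_simple_graph_edgeD(1)[OF G] by blast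
  show "{y, x} \<in> edges G" if "{x, y} \<in> edges G" for x y
    using that by (simp add: insert_commute)
  show "{x, y} \<in> edges G \<or> {x, z} \<in> edges G \<or> {y, z} \<in> edges G"
    if "{c, x} \<in> edges G" "{c, y} \<in> edges G" "{c, z} \<in> edges G" "x \<noteq> y" "x \<noteq> z" "y \<noteq> z" for c x y z
    using contains_claw[OF G that] assms(2) by blast
qed

lemma divisible_if_far_two_cliques:
  assumes G: "fin_simple_graph G" and X: "X \<subseteq> vertices G" "x \<in> X"
    and KL: "graph_clique G K" "graph_clique G L" "X - insert x (neighbourhood G x) = K \<union> L"
  shows "divisible G X"
proof -
  let ?N = "neighbourhood G x"
  let ?M = "X - insert x ?N"
  have "graph_clique G {x}" "graph_clique G {}" using X by (auto simp: graph_clique_def clique_def)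
  \<comment> \<open>\<open>x\<close> is isolated from \<open>?M\<close>, so the two perfect parts
    can be joined.\<close>
  then have "perfect (induced G {x})" using perfect_two_cliques[OF G, of "{x}" "{}"] by simp
  moreover have "perfect (induced G ?M)" using perfect_two_cliques[OF G KL(1,2)] KL(3) by simp
  ultimately have "perfect (induced G ({x} \<union> ?M))"
    by (intro perfect_Un_anticomplete[OF G]) (use X in \<open>auto simp: neighbourhood_def\<close>)
  moreover have "clique_number (induced G (X \<inter> ?N)) < clique_number (induced G X)"
  proof -
    have fin: "finite X" using fin_simple_graph_finite[OF G] X by blast
    then obtain Z where Z: "graph_clique (induced G (X \<inter> ?N)) Z"
      "card Z = clique_number (induced G (X \<inter> ?N))"
      using clique_number_attained[of "induced G (X \<inter> ?N)"] by auto
    have "x \<notin> ?N" using fin_simple_graph_no_loop[OF G] by (auto simp: neighbourhood_def)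
    then have "x \<notin> Z" using Z by (auto simp: graph_clique_induced)
    have "clique ({x} \<union> Z) (edges G)"
      by (rule clique_Un) (use Z in \<open>auto simp: graph_clique_induced clique_def neighbourhood_def\<close>)
    then have "card (insert x Z) \<le> clique_number (induced G X)"
      using Z X fin by (intro card_le_clique_number) (auto simp: graph_clique_induced)
    moreover have "finite Z" using Z fin by (auto simp: graph_clique_induced dest: finite_subset)
    ultimately show ?thesis using Z \<open>x \<notin> Z\<close> by simp
  qed
  moreover have "({x} \<union> ?M) \<union> (X \<inter> ?N) = X" "({x} \<union> ?M) \<inter> (X \<inter> ?N) = {}"
    using X \<open>x \<in> X\<close> fin_simple_graph_no_loop[OF G] by (auto simp: neighbourhood_def)
  ultimately show ?thesis unfolding divisible_def by blast
qed

theorem corollary1p6: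
  fixes G :: "'a ugraph"
  assumes "fin_simple_graph G"
    and "\<not> contains_induced G claw"
    and "\<not> perfectly_divisible G"
  shows "\<exists>v. trisimplicial G v"
proof (rule ccontr)
  assume no_trisimplicial: "\<nexists>v. trisimplicial G v"
  note G = assms(1)
  let ?adj = "\<lambda>u v. {u, v} \<in> edges G"
  interpret claw_free_graph "vertices G" ?adj using claw_free_graphI assms by blast
  have clq: "clq K \<longleftrightarrow> graph_clique G K" for K
    by (auto simp: clq_def graph_clique_def clique_def)
  have nbrs: "nbrs v = neighbourhood G v" for v
    using adj_V by (auto simp: nbrs_def neighbourhood_def)
  have no_tri: "\<not> tri v" for v
    using no_trisimplicial by (simp add: tri_def trisimplicial_def clq nbrs)
  let ?P = "\<lambda>X. X \<subseteq> vertices G \<and> X \<noteq> {} \<and> \<not> divisible G X"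
  obtain X0 where "?P X0" using assms(3) perfectly_divisible_iff by blast
  then obtain X where X: "?P X" and minimal: "\<And>Y. ?P Y \<Longrightarrow> card X \<le> card Y"
    using ex_has_least_nat[of ?P X0 card] by blast
  have finX: "finite X" using X fin_simple_graph_finite[OF G] by blast
  obtain x where x: "x \<in> X" using X by blast
  \<comment> \<open>\<open>C\<close> is the component of \<open>x\<close>: by
    \<open>near_adj\<close> no edge leaves it. If \<open>X\<close> were not inside, both
    \<open>X \<inter> C\<close> and \<open>X - C\<close> would be divisible by minimality.\<close>
  define C where "C = {u. near x u}"
  have "near x x" using x X by (auto simp: near_def)
  have sub_C: "X \<subseteq> C"
  proof (rule ccontr)
    assume nonsub: "\<not> X \<subseteq> C"
    have "divisible G (X \<inter> C)"
    proof (rule ccontr)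
      assume "\<not> ?thesis"
      then have "card X \<le> card (X \<inter> C)" using X x \<open>near x x\<close> by (intro minimal) (auto simp: C_def)
      moreover have "card (X \<inter> C) < card X" by (rule psubset_card_mono[OF finX]) (use nonsub in blast)
      ultimately show False by simp
    qed
    moreover have "divisible G (X - C)"
    proof (rule ccontr)
      assume "\<not> ?thesis"
      then have "card X \<le> card (X - C)" using X nonsub by (intro minimal) auto
      moreover have "card (X - C) < card X"
        by (rule psubset_card_mono[OF finX]) (use x \<open>near x x\<close> in \<open>auto simp: C_def\<close>)
      ultimately show False by simp
    qed
    moreover have "{a, b} \<notin> edges G" if "a \<in> X \<inter> C" "b \<in> X - C" for a b
      using near_adj[OF no_tri, of x a b] that by (auto simp: C_def)
    ultimately have "divisible G ((X \<inter> C) \<union> (X - C))"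
      using X by (intro divisible_Un_anticomplete[OF G]) auto
    moreover have "(X \<inter> C) \<union> (X - C) = X" by blast
    ultimately show False using X by simp
  qed
  \<comment> \<open>\<open>S\<close> need not be maximum itself; it only shows that a maximum
    pairwise near stable set has at least four vertices.\<close>
  have no_four: "card S < 4" if S: "stable S" "S \<subseteq> C" for S
  proof (rule ccontr)
    assume "\<not> card S < 4"
    let ?Q = "\<lambda>T. stable T \<and> (\<forall>a\<in>T. \<forall>b\<in>T. near a b)"
    have "near a b" if "a \<in> S" "b \<in> S" for a b
      using near_trans[OF no_tri near_sym, of x a b] that S by (auto simp: C_def)
    with S have "?Q S" by blast
    moreover have "card T < Suc (card (vertices G))" if "?Q T" for T
      using that finite_V card_mono by (auto simp: stable_def less_Suc_eq_le)
    ultimately obtain T where T: "?Q T" and max: "\<And>T'. ?Q T' \<Longrightarrow> card T' \<le> card T"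
      using ex_has_greatest_nat[of ?Q S card "Suc (card (vertices G))"] by blast
    have "4 \<le> card T" using max[OF \<open>?Q S\<close>] \<open>\<not> card S < 4\<close> by simp
    then obtain v z1 z2 z3 where "{v, z1, z2, z3} \<subseteq> T" "distinct [v, z1, z2, z3]"
      by (auto simp: card_le_Suc_iff numeral_eq_Suc)
    then show False
      using no_four_stable_if_no_tri[OF no_tri, of T v z1 z2 z3] T max by blast
  qed
  define M where "M = X - insert x (nbrs x)"
  have "tri x"
  proof (rule tri_if_not_two_cliques[of x M])
    show "M \<noteq> K \<union> L" if "clq K" "clq L" for K L
      using divisible_if_far_two_cliques[OF G, of X x K L] that X x
      unfolding M_def clq nbrs by blast
    show "card S \<noteq> 4" if "stable S" "S \<subseteq> insert x (M \<union> nbrs x)" for S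
    proof -
      have "nbrs x \<subseteq> C" using adj_V by (auto simp: nbrs_def C_def near_def)
      then have "S \<subseteq> C" using that sub_C x by (auto simp: M_def)
      then show ?thesis using no_four that by fastforce
    qed
  qed (use X x in \<open>auto simp: M_def nbrs_def\<close>)
  then show False using no_tri by blast
qed

end
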